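(* Let $A$ be a 4-dimensional complex 3-Lie algebra with basis $\{e_1,e_2,e_3,e_4\}$; below, the non-zero brackets of basis elements are listed up to skew-symmetry, and all parameters are arbitrary complex constants. In each of the following cases $(A,\Delta)$ is a double construction 3-Lie bialgebra. (1) $[e_1,e_2,e_3]=e_4$, $[e_1,e_2,e_4]=e_3$, $[e_1,e_3,e_4]=e_2$, $[e_2,e_3,e_4]=e_1$, and $\Delta(e_1)=k\,e_2\wedge e_3\wedge e_4$, $\Delta(e_2)=k\,e_1\wedge e_3\wedge e_4$, $\Delta(e_3)=k\,e_1\wedge e_2\wedge e_4$, $\Delta(e_4)=k\,e_1\wedge e_2\wedge e_3$. (2) $[e_2,e_3,e_4]=e_1$, and $\Delta(e_1)=0$, $\Delta(e_2)=k_1e_1\wedge e_2\wedge e_3+k_2e_1\wedge e_2\wedge e_4+c_1e_1\wedge e_3\wedge e_4$, $\Delta(e_3)=k_3e_1\wedge e_2\wedge e_3-k_2e_1\wedge e_3\wedge e_4+c_2e_1\wedge e_2\wedge e_4$, $\Delta(e_4)=-k_3e_1\wedge e_2\wedge e_4+k_1e_1\wedge e_3\wedge e_4+c_3e_1\wedge e_2\wedge e_3$. (3) $[e_2,e_3,e_4]=e_1$, $[e_1,e_3,e_4]=e_2$, and $\Delta(e_1)=\Delta(e_2)=0$, $\Delta(e_3)=k\,e_1\wedge e_2\wedge e_3+c_1e_1\wedge e_2\wedge e_4$, $\Delta(e_4)=-k\,e_1\wedge e_2\wedge e_4+c_2e_1\wedge e_2\wedge e_3$. (4) $[e_1,e_2,e_4]=e_3$,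 $[e_1,e_3,e_4]=e_2$, $[e_2,e_3,e_4]=e_1$, and $\Delta(e_1)=\Delta(e_2)=\Delta(e_3)=0$, $\Delta(e_4)=c\,e_1\wedge e_2\wedge e_3$.
   Context: A 3-Lie algebra is a vector space $A$ with a trilinear, totally skew-symmetric bracket $[\cdot,\cdot,\cdot]:\otimes^3A\to A$ such that for all $x_1,\dots,x_5\in A$: $[x_1,x_2,[x_3,x_4,x_5]]=[[x_1,x_2,x_3],x_4,x_5]+[x_3,[x_1,x_2,x_4],x_5]+[x_3,x_4,[x_1,x_2,x_5]]$. Put $\mathrm{ad}_{x,y}z=[x,y,z]$. A double construction 3-Lie bialgebra is a pair $(A,\Delta)$ of a 3-Lie algebra $A$ and a linear map $\Delta:A\to A\otimes A\otimes A$ such that the dual map $\Delta^*:A^*\otimes A^*\otimes A^*\to A^*$ defines a 3-Lie algebra structure on $A^*$ and for all $x,y,z\in A$: $\Delta([x,y,z])=(\mathrm{id}\otimes\mathrm{id}\otimes\mathrm{ad}_{y,z})\Delta(x)+(\mathrm{id}\otimes\mathrm{id}\otimes\mathrm{ad}_{z,x})\Delta(y)+(\mathrm{id}\otimes\mathrm{id}\otimes\mathrm{ad}_{x,y})\Delta(z)$ and $\Delta([x,y,z])=(\mathrm{id}\otimes\mathrm{id}\otimes\mathrm{ad}_{y,z})\Delta(x)+(\mathrm{id}\otimes\mathrm{ad}_{y,z}\otimes\mathrm{id})\Delta(x)+(\mathrm{ad}_{y,z}\otimes\mathrm{id}\otimes\mathrm{id})\Delta(x)$. Wedge convention: $v_1\wedge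 v_2\wedge v_3=\sum_{\sigma\in S_3}\mathrm{sgn}(\sigma)v_{\sigma(1)}\otimes v_{\sigma(2)}\otimes v_{\sigma(3)}$. *)

theory Defs
  imports Complex_Main "HOL-Library.Poly_Mapping"
begin

section \<open>Complex vector spaces\<close>

class complex_vector = ab_group_add +
  fixes scaleC :: "complex \<Rightarrow> 'a \<Rightarrow> 'a" (infixr "*\<^sub>C" 75)
  assumes scaleC_add_right: "a *\<^sub>C (x + y) = a *\<^sub>C x + a *\<^sub>C y"
    and scaleC_add_left: "(a + b) *\<^sub>C x = a *\<^sub>C x + b *\<^sub>C x"
    and scaleC_scaleC: "a *\<^sub>C b *\<^sub>C x = (a * b) *\<^sub>C x"
    and scaleC_one: "1 *\<^sub>C x = x"

global_interpretation cvector: vector_space "scaleC :: complex \<Rightarrow> 'a \<Rightarrow> 'a::complex_vector"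
  by unfold_locales (rule scaleC_add_right scaleC_add_left scaleC_scaleC scaleC_one)+

global_interpretation cvector: vector_space_pair
  "scaleC :: complex \<Rightarrow> 'a \<Rightarrow> 'a::complex_vector"
  "scaleC :: complex \<Rightarrow> 'b \<Rightarrow> 'b::complex_vector"
  by unfold_locales

abbreviation clinear :: "('a::complex_vector \<Rightarrow> 'b::complex_vector) \<Rightarrow> bool" where
  "clinear \<equiv> Vector_Spaces.linear scaleC scaleC"

lemma clinear_iff:
  "clinear f \<longleftrightarrow> (\<forall>x y. f (x + y) = f x + f y) \<and> (\<forall>c x. f (c *\<^sub>C x) = c *\<^sub>C f x)"
  by (simp add: Vector_Spaces.linear_iff cvector.vector_space_axioms)

definition trilinear ::
    "('a::complex_vector \<Rightarrow> 'b::complex_vector \<Rightarrow> 'c::complex_vector \<Rightarrow> 'd::complex_vector) \<Rightarrow> bool" where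
  "trilinear F \<longleftrightarrow>
     (\<forall>y z. clinear (\<lambda>x. F x y z)) \<and>
     (\<forall>x z. clinear (\<lambda>y. F x y z)) \<and>
     (\<forall>x y. clinear (\<lambda>z. F x y z))"

instantiation complex :: complex_vector
begin
definition scaleC_complex :: "complex \<Rightarrow> complex \<Rightarrow> complex" where
  "scaleC_complex = (*)"
instance
  by standard (simp_all add: scaleC_complex_def algebra_simps)
end

instantiation poly_mapping :: (type, complex_vector) complex_vector
begin
lift_definition scaleC_poly_mapping :: "complex \<Rightarrow> ('a \<Rightarrow>\<^sub>0 'b) \<Rightarrow> 'a \<Rightarrow>\<^sub>0 'b" is
  "\<lambda>c f x. c *\<^sub>C f x"
  by (erule finite_subset[rotated]) auto
instance
  by standard
    (transfer; simp add: fun_eq_iff scaleC_add_right scaleC_add_left scaleC_scaleC scaleC_one)+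
end

section \<open>The dual space\<close>

typedef (overloaded) 'a dual = "{f :: 'a::complex_vector \<Rightarrow> complex. clinear f}"
  morphisms dual_apply Abs_dual
  by (rule exI[of _ "\<lambda>_. 0"]) (simp add: clinear_iff)

setup_lifting type_definition_dual

instantiation dual :: (complex_vector) complex_vector
begin
lift_definition zero_dual :: "'a dual" is "\<lambda>_. 0" by (simp add: clinear_iff)
lift_definition plus_dual :: "'a dual \<Rightarrow> 'a dual \<Rightarrow> 'a dual" is "\<lambda>f g x. f x + g x"
  by (simp add: clinear_iff scaleC_add_right)
lift_definition minus_dual :: "'a dual \<Rightarrow> 'a dual \<Rightarrow> 'a dual" is "\<lambda>f g x. f x - g x"
  by (simp add: clinear_iff cvector.scale_right_diff_distrib)
lift_definition uminus_dual :: "'a dual \<Rightarrow> 'a dual" is "\<lambda>f x. - f x"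
  by (simp add: clinear_iff)
lift_definition scaleC_dual :: "complex \<Rightarrow> 'a dual \<Rightarrow> 'a dual" is "\<lambda>c f x. c *\<^sub>C f x"
  by (simp add: clinear_iff scaleC_add_right scaleC_scaleC mult.commute)
instance
  by standard (transfer; simp add: fun_eq_iff scaleC_complex_def algebra_simps)+
end

lemma clinear_dual_apply: "clinear (dual_apply f)"
  using dual_apply[of f] by simp

lemmas dual_apply_simps [simp] =
  zero_dual.rep_eq plus_dual.rep_eq minus_dual.rep_eq uminus_dual.rep_eq

lemma dual_apply_scaleC [simp]: "dual_apply (c *\<^sub>C f) x = c * dual_apply f x"
  by (simp add: scaleC_dual.rep_eq scaleC_complex_def)

definition dual_map :: "('a::complex_vector \<Rightarrow> 'b::complex_vector) \<Rightarrow> 'b dual \<Rightarrow> 'a dual" where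
  "dual_map L f = Abs_dual (\<lambda>x. dual_apply f (L x))"

lemma dual_apply_dual_map:
  assumes "clinear L"
  shows "dual_apply (dual_map L f) x = dual_apply f (L x)"
proof -
  have "clinear (\<lambda>x. dual_apply f (L x))"
    using assms clinear_dual_apply[of f] by (simp add: clinear_iff)
  then show ?thesis by (simp add: dual_map_def Abs_dual_inverse)
qed

section \<open>The threefold tensor power\<close>

text \<open>\<open>A \<otimes> A \<otimes> A\<close> is the free vector space on \<open>A \<times> A \<times> A\<close> modulo the span of the relations
  that make \<open>(x, y, z) \<mapsto> x \<otimes> y \<otimes> z\<close> trilinear.\<close>

abbreviation gen3 :: "'a \<Rightarrow> 'a \<Rightarrow> 'a \<Rightarrow> ('a \<times> 'a \<times> 'a) \<Rightarrow>\<^sub>0 complex" where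
  "gen3 x y z \<equiv> Poly_Mapping.single (x, y, z) 1"

inductive_set tensor3_relations :: "(('a::complex_vector \<times> 'a \<times> 'a) \<Rightarrow>\<^sub>0 complex) set" where
  "gen3 (x + x') y z - gen3 x y z - gen3 x' y z \<in> tensor3_relations"
| "gen3 x (y + y') z - gen3 x y z - gen3 x y' z \<in> tensor3_relations"
| "gen3 x y (z + z') - gen3 x y z - gen3 x y z' \<in> tensor3_relations"
| "gen3 (c *\<^sub>C x) y z - c *\<^sub>C gen3 x y z \<in> tensor3_relations"
| "gen3 x (c *\<^sub>C y) z - c *\<^sub>C gen3 x y z \<in> tensor3_relations"
| "gen3 x y (c *\<^sub>C z) - c *\<^sub>C gen3 x y z \<in> tensor3_relations"

definition tensor3_rel ::
    "(('a::complex_vector \<times> 'a \<times> 'a) \<Rightarrow>\<^sub>0 complex) \<Rightarrow> (('a \<times> 'a \<times> 'a) \<Rightarrow>\<^sub>0 complex) \<Rightarrow> bool" where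
  "tensor3_rel p q \<longleftrightarrow> p - q \<in> cvector.span tensor3_relations"

lemma equivp_tensor3_rel:
  "equivp (tensor3_rel :: (('a::complex_vector \<times> 'a \<times> 'a) \<Rightarrow>\<^sub>0 complex) \<Rightarrow> _)"
proof (rule equivpI)
  show "reflp (tensor3_rel :: (('a \<times> 'a \<times> 'a) \<Rightarrow>\<^sub>0 complex) \<Rightarrow> _)"
    by (simp add: reflp_def tensor3_rel_def cvector.span_zero)
  show "symp (tensor3_rel :: (('a \<times> 'a \<times> 'a) \<Rightarrow>\<^sub>0 complex) \<Rightarrow> _)"
  proof (rule sympI)
    fix p q :: "('a \<times> 'a \<times> 'a) \<Rightarrow>\<^sub>0 complex"
    assume "tensor3_rel p q"
    then show "tensor3_rel q p"
      using cvector.span_neg[of "p - q" tensor3_relations] by (simp add: tensor3_rel_def)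
  qed
  show "transp (tensor3_rel :: (('a \<times> 'a \<times> 'a) \<Rightarrow>\<^sub>0 complex) \<Rightarrow> _)"
  proof (rule transpI)
    fix p q r :: "('a \<times> 'a \<times> 'a) \<Rightarrow>\<^sub>0 complex"
    assume "tensor3_rel p q" "tensor3_rel q r"
    then show "tensor3_rel p r"
      using cvector.span_add[of "p - q" tensor3_relations "q - r"] by (simp add: tensor3_rel_def)
  qed
qed

lemma tensor3_rel_add: "tensor3_rel p p' \<Longrightarrow> tensor3_rel q q' \<Longrightarrow> tensor3_rel (p + q) (p' + q')"
  using cvector.span_add[of "p - p'" tensor3_relations "q - q'"]
  by (simp add: tensor3_rel_def algebra_simps)

lemma tensor3_rel_scaleC: "tensor3_rel p q \<Longrightarrow> tensor3_rel (c *\<^sub>C p) (c *\<^sub>C q)"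
  using cvector.span_scale[of "p - q" tensor3_relations c]
  by (simp add: tensor3_rel_def cvector.scale_right_diff_distrib)

lemma tensor3_rel_uminus: "tensor3_rel p q \<Longrightarrow> tensor3_rel (- p) (- q)"
  using tensor3_rel_scaleC[of p q "- 1"] by simp

lemma tensor3_rel_diff: "tensor3_rel p p' \<Longrightarrow> tensor3_rel q q' \<Longrightarrow> tensor3_rel (p - q) (p' - q')"
  using tensor3_rel_add[OF _ tensor3_rel_uminus, of p p' q q'] by simp

lemma tensor3_rel_eqI: "p = q \<Longrightarrow> tensor3_rel p q"
  by (simp add: tensor3_rel_def cvector.span_zero)

quotient_type (overloaded) 'a tensor3 =
  "('a::complex_vector \<times> 'a \<times> 'a) \<Rightarrow>\<^sub>0 complex" / tensor3_rel
  by (rule equivp_tensor3_rel)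

instantiation tensor3 :: (complex_vector) complex_vector
begin
lift_definition zero_tensor3 :: "'a tensor3" is 0 .
lift_definition plus_tensor3 :: "'a tensor3 \<Rightarrow> 'a tensor3 \<Rightarrow> 'a tensor3" is "(+)"
  by (rule tensor3_rel_add)
lift_definition minus_tensor3 :: "'a tensor3 \<Rightarrow> 'a tensor3 \<Rightarrow> 'a tensor3" is "(-)"
  by (rule tensor3_rel_diff)
lift_definition uminus_tensor3 :: "'a tensor3 \<Rightarrow> 'a tensor3" is uminus
  by (rule tensor3_rel_uminus)
lift_definition scaleC_tensor3 :: "complex \<Rightarrow> 'a tensor3 \<Rightarrow> 'a tensor3" is scaleC
  by (rule tensor3_rel_scaleC)
instance
  by standard
    (transfer; rule tensor3_rel_eqI;
      simp add: scaleC_add_right scaleC_add_left scaleC_scaleC scaleC_one)+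
end

lift_definition tensor :: "'a::complex_vector \<Rightarrow> 'a \<Rightarrow> 'a \<Rightarrow> 'a tensor3"
  ("_ \<otimes> _ \<otimes> _" [76, 76, 76] 75) is gen3 .

lemma trilinear_tensor: "trilinear tensor"
  unfolding trilinear_def clinear_iff
  by (intro conjI allI; transfer; unfold tensor3_rel_def)
    (simp_all only: diff_diff_eq[symmetric] tensor3_relations.intros cvector.span_base)

lemma tensor_simps:
  "(x + x') \<otimes> y \<otimes> z = x \<otimes> y \<otimes> z + x' \<otimes> y \<otimes> z"
  "x \<otimes> (y + y') \<otimes> z = x \<otimes> y \<otimes> z + x \<otimes> y' \<otimes> z"
  "x \<otimes> y \<otimes> (z + z') = x \<otimes> y \<otimes> z + x \<otimes> y \<otimes> z'"
  "(c *\<^sub>C x) \<otimes> y \<otimes> z = c *\<^sub>C (x \<otimes> y \<otimes> z)"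
  "x \<otimes> (c *\<^sub>C y) \<otimes> z = c *\<^sub>C (x \<otimes> y \<otimes> z)"
  "x \<otimes> y \<otimes> (c *\<^sub>C z) = c *\<^sub>C (x \<otimes> y \<otimes> z)"
  using trilinear_tensor unfolding trilinear_def clinear_iff by blast+

text \<open>The linear extension of a function on generators to the free vector space.\<close>

definition free_extension :: "('k \<Rightarrow> 'v::complex_vector) \<Rightarrow> ('k \<Rightarrow>\<^sub>0 complex) \<Rightarrow> 'v" where
  "free_extension F p = (\<Sum>k\<in>Poly_Mapping.keys p. Poly_Mapping.lookup p k *\<^sub>C F k)"

lemma free_extension_superset:
  fixes F :: "'k \<Rightarrow> 'v::complex_vector"
  assumes "finite K" "Poly_Mapping.keys p \<subseteq> K"
  shows "free_extension F p = (\<Sum>k\<in>K. Poly_Mapping.lookup p k *\<^sub>C F k)"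
  unfolding free_extension_def
  by (rule sum.mono_neutral_left) (use assms in \<open>auto simp: in_keys_iff\<close>)

lemma free_extension_single [simp]: "free_extension F (Poly_Mapping.single k 1) = F k"
  by (simp add: free_extension_def scaleC_one)

lemma clinear_free_extension: "clinear (free_extension F)"
  unfolding clinear_iff
proof (intro conjI allI)
  fix p q :: "'a \<Rightarrow>\<^sub>0 complex"
  let ?K = "Poly_Mapping.keys p \<union> Poly_Mapping.keys q"
  have "Poly_Mapping.keys (p + q) \<subseteq> ?K" by (rule Poly_Mapping.keys_add)
  then show "free_extension F (p + q) = free_extension F p + free_extension F q"
    by (simp add: free_extension_superset[of ?K] lookup_add scaleC_add_left sum.distrib)
next
  fix c and p :: "'a \<Rightarrow>\<^sub>0 complex"
  have "Poly_Mapping.keys (c *\<^sub>C p) \<subseteq> Poly_Mapping.keys p"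
    by (auto simp: in_keys_iff scaleC_poly_mapping.rep_eq)
  then show "free_extension F (c *\<^sub>C p) = c *\<^sub>C free_extension F p"
    by (simp add: free_extension_superset[of "Poly_Mapping.keys p"] scaleC_poly_mapping.rep_eq
        scaleC_complex_def cvector.scale_sum_right scaleC_scaleC)
qed

lemma free_extension_eq:
  assumes "clinear L"
  shows "L p = free_extension (\<lambda>k. L (Poly_Mapping.single k 1)) p"
proof -
  have "p = free_extension (\<lambda>k. Poly_Mapping.single k 1) p"
  proof (rule poly_mapping_eqI)
    fix k
    have "Poly_Mapping.lookup (free_extension (\<lambda>k. Poly_Mapping.single k 1) p) k =
      (\<Sum>i\<in>Poly_Mapping.keys p. if i = k then Poly_Mapping.lookup p i else 0)"
      unfolding free_extension_def lookup_sum
      by (rule sum.cong)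
        (auto simp: scaleC_poly_mapping.rep_eq scaleC_complex_def lookup_single when_def)
    then show "Poly_Mapping.lookup p k =
        Poly_Mapping.lookup (free_extension (\<lambda>k. Poly_Mapping.single k 1) p) k"
      by (simp add: in_keys_iff)
  qed
  then have "L p = L (free_extension (\<lambda>k. Poly_Mapping.single k 1) p)" by simp
  also have "\<dots> = free_extension (\<lambda>k. L (Poly_Mapping.single k 1)) p"
    unfolding free_extension_def
    by (simp add: cvector.linear_sum[OF assms] cvector.linear_scale[OF assms])
  finally show ?thesis .
qed

lemma free_extension_tensor3_rel:
  assumes "trilinear F" "tensor3_rel p q"
  shows "free_extension (\<lambda>(x, y, z). F x y z) p = free_extension (\<lambda>(x, y, z). F x y z) q"
proof -
  let ?E = "free_extension (\<lambda>(x, y, z). F x y z)"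
  note lin = clinear_free_extension[of "\<lambda>(x, y, z). F x y z"]
  have "?E r = 0" if "r \<in> tensor3_relations" for r
    using that assms(1)
    by cases
      (simp_all add: cvector.linear_diff[OF lin] cvector.linear_scale[OF lin] trilinear_def
        clinear_iff)
  then have "?E (p - q) = 0"
    using assms(2) cvector.linear_eq_0_on_span[OF lin] unfolding tensor3_rel_def by blast
  then show ?thesis by (simp add: cvector.linear_diff[OF lin])
qed

text \<open>The universal property of \<open>A \<otimes> A \<otimes> A\<close>.\<close>

theorem tensor3_universal:
  fixes F :: "'a::complex_vector \<Rightarrow> 'a \<Rightarrow> 'a \<Rightarrow> 'v::complex_vector"
  assumes "trilinear F"
  shows "\<exists>!L. clinear L \<and> (\<forall>x y z. L (x \<otimes> y \<otimes> z) = F x y z)"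
proof (rule ex_ex1I)
  let ?E = "free_extension (\<lambda>(x, y, z). F x y z)"
  define L where "L t = ?E (rep_tensor3 t)" for t
  have L: "L (abs_tensor3 p) = ?E p" for p
    unfolding L_def
    by (rule free_extension_tensor3_rel[OF assms])
      (rule Quotient3_rep_abs[OF Quotient3_tensor3 tensor3_rel_eqI[OF refl]])
  have "clinear L"
    unfolding clinear_iff
  proof (intro conjI allI)
    fix s t :: "'a tensor3" and c
    obtain p q where [simp]: "s = abs_tensor3 p" "t = abs_tensor3 q"
      by (metis Quotient3_abs_rep[OF Quotient3_tensor3])
    show "L (s + t) = L s + L t"
      using clinear_free_extension[of "\<lambda>(x, y, z). F x y z"]
      by (simp add: plus_tensor3.abs_eq L clinear_iff)
    show "L (c *\<^sub>C t) = c *\<^sub>C L t"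
      using clinear_free_extension[of "\<lambda>(x, y, z). F x y z"]
      by (simp add: scaleC_tensor3.abs_eq L clinear_iff)
  qed
  moreover have "L (x \<otimes> y \<otimes> z) = F x y z" for x y z
    by (simp add: tensor.abs_eq L)
  ultimately show "\<exists>L. clinear L \<and> (\<forall>x y z. L (x \<otimes> y \<otimes> z) = F x y z)" by blast
next
  fix L M :: "'a tensor3 \<Rightarrow> 'v"
  assume L: "clinear L \<and> (\<forall>x y z. L (x \<otimes> y \<otimes> z) = F x y z)"
    and M: "clinear M \<and> (\<forall>x y z. M (x \<otimes> y \<otimes> z) = F x y z)"
  have eq: "N (abs_tensor3 p) = free_extension (\<lambda>(x, y, z). F x y z) p"
    if N: "clinear N \<and> (\<forall>x y z. N (x \<otimes> y \<otimes> z) = F x y z)" for N p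
  proof -
    have "clinear (\<lambda>p. N (abs_tensor3 p))"
      using N by (simp add: clinear_iff plus_tensor3.abs_eq[symmetric] scaleC_tensor3.abs_eq[symmetric])
    moreover have "(\<lambda>k. N (abs_tensor3 (Poly_Mapping.single k 1))) = (\<lambda>(x, y, z). F x y z)"
      using N by (auto simp: tensor.abs_eq)
    ultimately show ?thesis using free_extension_eq[of "\<lambda>p. N (abs_tensor3 p)" p] by simp
  qed
  show "L = M"
  proof
    fix t show "L t = M t" by (induction t rule: tensor3.abs_induct) (simp add: eq[OF L] eq[OF M])
  qed
qed

definition tensor3_lift ::
    "('a::complex_vector \<Rightarrow> 'a \<Rightarrow> 'a \<Rightarrow> 'v::complex_vector) \<Rightarrow> 'a tensor3 \<Rightarrow> 'v" where
  "tensor3_lift F = (THE L. clinear L \<and> (\<forall>x y z. L (x \<otimes> y \<otimes> z) = F x y z))"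

lemma tensor3_lift:
  assumes "trilinear F"
  shows clinear_tensor3_lift: "clinear (tensor3_lift F)"
    and tensor3_lift_tensor: "tensor3_lift F (x \<otimes> y \<otimes> z) = F x y z"
  using theI'[OF tensor3_universal[OF assms]] by (simp_all add: tensor3_lift_def)

definition tensor_map ::
    "('a::complex_vector \<Rightarrow> 'b::complex_vector) \<Rightarrow> ('a \<Rightarrow> 'b) \<Rightarrow> ('a \<Rightarrow> 'b) \<Rightarrow> 'a tensor3 \<Rightarrow> 'b tensor3"
  where "tensor_map f g h = tensor3_lift (\<lambda>x y z. f x \<otimes> g y \<otimes> h z)"

lemma tensor_map:
  assumes "clinear f" "clinear g" "clinear h"
  shows clinear_tensor_map: "clinear (tensor_map f g h)"
    and tensor_map_tensor: "tensor_map f g h (x \<otimes> y \<otimes> z) = f x \<otimes> g y \<otimes> h z"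
proof -
  have "trilinear (\<lambda>x y z. f x \<otimes> g y \<otimes> h z)"
    using assms by (simp add: trilinear_def clinear_iff tensor_simps)
  then show "clinear (tensor_map f g h)" "tensor_map f g h (x \<otimes> y \<otimes> z) = f x \<otimes> g y \<otimes> h z"
    by (simp_all add: tensor_map_def tensor3_lift)
qed

text \<open>The canonical map \<open>A\<^sup>* \<otimes> A\<^sup>* \<otimes> A\<^sup>* \<rightarrow> (A \<otimes> A \<otimes> A)\<^sup>*\<close>, which sends \<open>f \<otimes> g \<otimes> h\<close> to
  the functional with value \<open>f x * g y * h z\<close> at \<open>x \<otimes> y \<otimes> z\<close>.\<close>

definition dual_tensor :: "'a::complex_vector dual tensor3 \<Rightarrow> 'a tensor3 dual" where
  "dual_tensor =
     tensor3_lift (\<lambda>f g h.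
       Abs_dual (tensor3_lift (\<lambda>x y z. dual_apply f x * dual_apply g y * dual_apply h z)))"

lemma dual_eqI: "(\<And>x. dual_apply f x = dual_apply g x) \<Longrightarrow> f = g"
  by (simp add: dual_apply_inject[symmetric] fun_eq_iff)

lemma tensor3_dual_eqI:
  fixes \<phi> \<psi> :: "'a::complex_vector tensor3 dual"
  assumes "\<And>x y z. dual_apply \<phi> (x \<otimes> y \<otimes> z) = dual_apply \<psi> (x \<otimes> y \<otimes> z)"
  shows "\<phi> = \<psi>"
proof (rule dual_eqI)
  have "trilinear (\<lambda>x y z. dual_apply \<phi> (x \<otimes> y \<otimes> z))"
    using clinear_dual_apply[of \<phi>] by (simp add: trilinear_def clinear_iff tensor_simps)
  from tensor3_universal[OF this] have "dual_apply \<phi> = dual_apply \<psi>"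
    using assms clinear_dual_apply[of \<phi>] clinear_dual_apply[of \<psi>] by (metis (no_types, lifting))
  then show "dual_apply \<phi> t = dual_apply \<psi> t" for t by simp
qed

lemma dual_tensor:
  fixes f g h :: "'a::complex_vector dual"
  shows clinear_dual_tensor: "clinear (dual_tensor :: 'a dual tensor3 \<Rightarrow> _)"
    and dual_tensor_tensor: "dual_apply (dual_tensor (f \<otimes> g \<otimes> h)) (x \<otimes> y \<otimes> z) =
      dual_apply f x * dual_apply g y * dual_apply h z"
proof -
  define P where "P f g h = Abs_dual (tensor3_lift
    (\<lambda>x y z :: 'a. dual_apply f x * dual_apply g y * dual_apply h z))" for f g h
  have tri: "trilinear (\<lambda>x y z :: 'a. dual_apply f x * dual_apply g y * dual_apply h z)" for f g h
    using clinear_dual_apply[of f] clinear_dual_apply[of g] clinear_dual_apply[of h]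
    unfolding trilinear_def clinear_iff by (simp add: scaleC_complex_def algebra_simps)
  have P: "dual_apply (P f g h) (x \<otimes> y \<otimes> z) = dual_apply f x * dual_apply g y * dual_apply h z"
    for f g h x y z
    by (simp add: P_def Abs_dual_inverse tensor3_lift[OF tri])
  have "trilinear P"
    unfolding trilinear_def clinear_iff
    by (intro conjI allI; rule tensor3_dual_eqI; simp add: P algebra_simps)
  note lift = tensor3_lift[OF this]
  have eq: "dual_tensor = tensor3_lift P"
    by (simp add: dual_tensor_def P_def[abs_def])
  show "clinear (dual_tensor :: 'a dual tensor3 \<Rightarrow> _)"
    unfolding eq by (rule lift(1))
  show "dual_apply (dual_tensor (f \<otimes> g \<otimes> h)) (x \<otimes> y \<otimes> z) =
      dual_apply f x * dual_apply g y * dual_apply h z"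
    unfolding eq lift(2) by (rule P)
qed

definition wedge :: "'a::complex_vector \<Rightarrow> 'a \<Rightarrow> 'a \<Rightarrow> 'a tensor3" where
  "wedge x y z =
     x \<otimes> y \<otimes> z + y \<otimes> z \<otimes> x + z \<otimes> x \<otimes> y - y \<otimes> x \<otimes> z - x \<otimes> z \<otimes> y - z \<otimes> y \<otimes> x"

section \<open>3-Lie algebras and double construction 3-Lie bialgebras\<close>

definition skew_symmetric3 :: "('a \<Rightarrow> 'a \<Rightarrow> 'a \<Rightarrow> 'a::complex_vector) \<Rightarrow> bool" where
  "skew_symmetric3 br \<longleftrightarrow>
     (\<forall>x y z. br y x z = - br x y z \<and> br x z y = - br x y z \<and> br z y x = - br x y z)"

definition three_lie_algebra :: "('a::complex_vector \<Rightarrow> 'a \<Rightarrow> 'a \<Rightarrow> 'a) \<Rightarrow> bool" where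
  "three_lie_algebra br \<longleftrightarrow>
     trilinear br \<and> skew_symmetric3 br \<and>
     (\<forall>x1 x2 x3 x4 x5.
        br x1 x2 (br x3 x4 x5) =
          br (br x1 x2 x3) x4 x5 + br x3 (br x1 x2 x4) x5 + br x3 x4 (br x1 x2 x5))"

text \<open>The dual \<open>\<Delta>\<^sup>* : A\<^sup>* \<otimes> A\<^sup>* \<otimes> A\<^sup>* \<rightarrow> A\<^sup>*\<close> of \<open>\<Delta> : A \<rightarrow> A \<otimes> A \<otimes> A\<close>.\<close>

definition cobracket_dual ::
    "('a::complex_vector \<Rightarrow> 'a tensor3) \<Rightarrow> 'a dual tensor3 \<Rightarrow> 'a dual" where
  "cobracket_dual \<Delta> t = dual_map \<Delta> (dual_tensor t)"

definition double_construction_3_lie_bialgebra ::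
    "('a::complex_vector \<Rightarrow> 'a \<Rightarrow> 'a \<Rightarrow> 'a) \<Rightarrow> ('a \<Rightarrow> 'a tensor3) \<Rightarrow> bool" where
  "double_construction_3_lie_bialgebra br \<Delta> \<longleftrightarrow>
     three_lie_algebra br \<and>
     clinear \<Delta> \<and>
     three_lie_algebra (\<lambda>f g h. cobracket_dual \<Delta> (f \<otimes> g \<otimes> h)) \<and>
     (\<forall>x y z. \<Delta> (br x y z) =
        tensor_map id id (br y z) (\<Delta> x) +
        tensor_map id id (br z x) (\<Delta> y) +
        tensor_map id id (br x y) (\<Delta> z)) \<and>
     (\<forall>x y z. \<Delta> (br x y z) =
        tensor_map id id (br y z) (\<Delta> x) +
        tensor_map id (br y z) id (\<Delta> x) +
        tensor_map (br y z) id id (\<Delta> x))"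

end

(* A tensor over a space with a finite basis vanishes iff every functional f \<otimes> g \<otimes> h kills it,
   and the transpose of tensor_map F G H maps f \<otimes> g \<otimes> h to (f \<circ> F) \<otimes> (g \<circ> G) \<otimes> (h \<circ> H). So
   both compatibility conditions, like the fundamental identity on the dual, become identities
   between values of the dual bracket. The bracket is the 3x3 minors of the coordinates times the
   four basic brackets, and dually a wedge pairs with f \<otimes> g \<otimes> h to a 3x3 minor; each condition is thus
   a polynomial identity in coordinates, valid for all values of the parameters. *)
theory Submission
  imports Defs
begin

section \<open>Linear maps out of the tensor cube and the dual of the cobracket\<close>

lemma clinear_sum: "(\<And>i. i \<in> I \<Longrightarrow> clinear (F i)) \<Longrightarrow> clinear (\<lambda>x. \<Sum>i\<in>I. F i x)"
  by (simp add: clinear_iff sum.distrib cvector.scale_sum_right)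

text \<open>Uniqueness in the universal property, applied to the trilinear map that \<open>M\<close>
  induces on pure tensors.\<close>

lemma clinear_tensor3_eqI:
  fixes L M :: "'a::complex_vector tensor3 \<Rightarrow> 'b::complex_vector"
  assumes L: "clinear L" and M: "clinear M"
    and eq: "\<And>x y z. L (x \<otimes> y \<otimes> z) = M (x \<otimes> y \<otimes> z)"
  shows "L t = M t"
proof -
  have "trilinear (\<lambda>x y z. M (x \<otimes> y \<otimes> z))"
    using M by (simp add: trilinear_def clinear_iff tensor_simps)
  from tensor3_universal[OF this] have "L = M"
    using assms by (metis (no_types, lifting))
  then show ?thesis by simp
qed

lemma dual_apply_linear:
  "dual_apply f (x + y) = dual_apply f x + dual_apply f y"
  "dual_apply f (x - y) = dual_apply f x - dual_apply f y"
  "dual_apply f (- x) = - dual_apply f x"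
  "dual_apply f 0 = 0"
  "dual_apply f (c *\<^sub>C x) = c * dual_apply f x"
  using cvector.linear_scale[OF clinear_dual_apply[of f]]
  by (simp_all add: cvector.linear_add[OF clinear_dual_apply] cvector.linear_diff[OF clinear_dual_apply]
      cvector.linear_neg[OF clinear_dual_apply] cvector.linear_0[OF clinear_dual_apply] scaleC_complex_def)

lemma cobracket_dual_apply:
  "clinear \<Delta> \<Longrightarrow> dual_apply (cobracket_dual \<Delta> t) x = dual_apply (dual_tensor t) (\<Delta> x)"
  by (simp add: cobracket_dual_def dual_apply_dual_map)

lemma clinear_bracket: "three_lie_algebra br \<Longrightarrow> clinear (br x y)"
  by (simp add: three_lie_algebra_def trilinear_def)

lemmas dual_apply_dual_map_bracket = dual_apply_dual_map[OF clinear_bracket]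

text \<open>The tensor symbol is trilinear, and \<open>dual_tensor\<close> followed by the transpose
  of \<Delta> is linear.\<close>

lemma trilinear_cobracket_dual:
  assumes "clinear \<Delta>"
  shows "trilinear (\<lambda>f g h. cobracket_dual \<Delta> (f \<otimes> g \<otimes> h))"
  unfolding trilinear_def clinear_iff cobracket_dual_def
  by (auto intro!: dual_eqI simp: dual_apply_dual_map[OF assms] tensor_simps
      cvector.linear_add[OF clinear_dual_tensor] cvector.linear_scale[OF clinear_dual_tensor])

lemma dual_tensor_tensor_map:
  assumes "clinear F" "clinear G" "clinear H"
  shows "dual_apply (dual_tensor (f \<otimes> g \<otimes> h)) (tensor_map F G H t) =
    dual_apply (dual_tensor (dual_map F f \<otimes> dual_map G g \<otimes> dual_map H h)) t"
proof (rule clinear_tensor3_eqI[where t = t])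
  show "clinear (\<lambda>t. dual_apply (dual_tensor (f \<otimes> g \<otimes> h)) (tensor_map F G H t))"
    using clinear_tensor_map[OF assms]
    unfolding clinear_iff by (simp add: dual_apply_linear scaleC_complex_def)
qed (simp_all add: clinear_dual_apply tensor_map_tensor assms dual_tensor_tensor dual_apply_dual_map)

section \<open>Coordinates, and functionals that separate tensors\<close>

text \<open>\<open>Abs_dual\<close> is meaningful here once \<open>representation\<close> is linear
  in the vector; \<open>dual_apply_coord\<close> derives this from independence and
  spanning.\<close>

definition coord :: "'a::complex_vector set \<Rightarrow> 'a \<Rightarrow> 'a dual" where
  "coord B b = Abs_dual (\<lambda>x. cvector.representation B x b)"

context
  fixes B :: "'a::complex_vector set"
  assumes indep: "cvector.independent B" and spanning: "cvector.span B = UNIV"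
begin

lemma dual_apply_coord: "dual_apply (coord B b) x = cvector.representation B x b"
proof -
  have "clinear (\<lambda>x. cvector.representation B x b)"
    unfolding clinear_iff
    by (simp add: cvector.representation_add cvector.representation_scale indep spanning
        scaleC_complex_def)
  then show ?thesis by (simp add: coord_def Abs_dual_inverse)
qed

lemma coord_basis: "a \<in> B \<Longrightarrow> dual_apply (coord B b) a = (if a = b then 1 else 0)"
  by (simp add: dual_apply_coord cvector.representation_basis indep)

lemma basis_expansion:
  assumes "finite B"
  shows "(\<Sum>b\<in>B. dual_apply (coord B b) x *\<^sub>C b) = x"
  by (simp add: dual_apply_coord cvector.sum_representation_eq indep spanning assms)

text \<open>A tensor can be rebuilt from its pairings with products of coordinate functionals: the
  map \<open>L\<close> doing so is the identity, yet its value depends on those pairings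
  only.\<close>

lemma tensor3_eqI:
  fixes s t :: "'a tensor3"
  assumes fin: "finite B"
    and eq: "\<And>f g h. dual_apply (dual_tensor (f \<otimes> g \<otimes> h)) s = dual_apply (dual_tensor (f \<otimes> g \<otimes> h)) t"
  shows "s = t"
proof -
  define L where "L t = (\<Sum>a\<in>B. \<Sum>b\<in>B. \<Sum>c\<in>B.
    dual_apply (dual_tensor (coord B a \<otimes> coord B b \<otimes> coord B c)) t *\<^sub>C (a \<otimes> b \<otimes> c))"
    for t :: "'a tensor3"
  have "L u = u" for u
  proof (rule clinear_tensor3_eqI[where t = u])
    show "clinear L"
      unfolding L_def
      by (intro clinear_sum) (simp add: clinear_iff scaleC_add_left scaleC_scaleC dual_apply_linear)
    fix x y z :: 'a
    have sum1: "(\<Sum>a\<in>B. F a) \<otimes> v \<otimes> w = (\<Sum>a\<in>B. F a \<otimes> v \<otimes> w)"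
      and sum2: "v \<otimes> (\<Sum>a\<in>B. F a) \<otimes> w = (\<Sum>a\<in>B. v \<otimes> F a \<otimes> w)"
      and sum3: "v \<otimes> w \<otimes> (\<Sum>a\<in>B. F a) = (\<Sum>a\<in>B. v \<otimes> w \<otimes> F a)" for F :: "'a \<Rightarrow> 'a" and v w
      using trilinear_tensor[where 'a = 'a] unfolding trilinear_def
      by (simp_all add: cvector.linear_sum[where f = "\<lambda>x. x \<otimes> v \<otimes> w"]
        cvector.linear_sum[where f = "\<lambda>x. v \<otimes> x \<otimes> w"] cvector.linear_sum[where f = "\<lambda>x. v \<otimes> w \<otimes> x"])
    have "L (x \<otimes> y \<otimes> z) = (\<Sum>a\<in>B. dual_apply (coord B a) x *\<^sub>C a) \<otimes>
        (\<Sum>b\<in>B. dual_apply (coord B b) y *\<^sub>C b) \<otimes> (\<Sum>c\<in>B. dual_apply (coord B c) z *\<^sub>C c)"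
      \<comment> \<open>One slot at a time, so that the sums come out nested in the order
        \<open>a\<close>, \<open>b\<close>, \<open>c\<close> of \<open>L\<close>.\<close>
      unfolding sum1 unfolding sum2 unfolding sum3
      by (simp add: L_def dual_tensor_tensor tensor_simps scaleC_scaleC ac_simps)
    then show "L (x \<otimes> y \<otimes> z) = x \<otimes> y \<otimes> z" by (simp only: basis_expansion[OF fin])
  qed (simp add: clinear_iff)
  moreover have "L s = L t" by (simp add: L_def eq)
  ultimately show ?thesis by metis
qed

end

text \<open>The determinant of the 3x3 matrix of values. It serves twice: to evaluate \<Delta>, and
  to give the coefficients in \<open>bracket_expansion\<close>.\<close>

lemma dual_tensor_wedge:
  "dual_apply (dual_tensor (f \<otimes> g \<otimes> h)) (wedge x y z) =
    dual_apply f x * dual_apply g y * dual_apply h z + dual_apply f y * dual_apply g z * dual_apply h x +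
    dual_apply f z * dual_apply g x * dual_apply h y - dual_apply f y * dual_apply g x * dual_apply h z -
    dual_apply f x * dual_apply g z * dual_apply h y - dual_apply f z * dual_apply g y * dual_apply h x"
  by (simp add: wedge_def dual_apply_linear dual_tensor_tensor)

section \<open>Coordinates in a four-dimensional space\<close>

text \<open>Independence of the set alone would allow repeated vectors; \<open>dist\<close> fixes
  the dimension at four.\<close>

locale basis4 =
  fixes e1 e2 e3 e4 :: "'a::complex_vector"
  assumes dist: "distinct [e1, e2, e3, e4]"
    and indep: "cvector.independent {e1, e2, e3, e4}"
    and spanning: "cvector.span {e1, e2, e3, e4} = UNIV"
begin

abbreviation "co \<equiv> \<lambda>b. dual_apply (coord {e1, e2, e3, e4} b)"

lemma expansion: "x = co e1 x *\<^sub>C e1 + co e2 x *\<^sub>C e2 + co e3 x *\<^sub>C e3 + co e4 x *\<^sub>C e4"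
  using basis_expansion[OF indep spanning, of x] dist by (simp add: add.assoc)

lemma co_basis:
  "co e1 e1 = 1" "co e1 e2 = 0" "co e1 e3 = 0" "co e1 e4 = 0"
  "co e2 e1 = 0" "co e2 e2 = 1" "co e2 e3 = 0" "co e2 e4 = 0"
  "co e3 e1 = 0" "co e3 e2 = 0" "co e3 e3 = 1" "co e3 e4 = 0"
  "co e4 e1 = 0" "co e4 e2 = 0" "co e4 e3 = 0" "co e4 e4 = 1"
  using dist by (auto simp: coord_basis[OF indep spanning])

lemma dual_expansion:
  "dual_apply f x = co e1 x * dual_apply f e1 + co e2 x * dual_apply f e2 +
     co e3 x * dual_apply f e3 + co e4 x * dual_apply f e4"
  by (subst expansion) (simp only: dual_apply_linear)

lemma dual_basis_eqI:
  assumes "dual_apply f e1 = dual_apply g e1" "dual_apply f e2 = dual_apply g e2"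
    "dual_apply f e3 = dual_apply g e3" "dual_apply f e4 = dual_apply g e4"
  shows "f = g"
proof (rule dual_eqI)
  show "dual_apply f x = dual_apply g x" for x
    unfolding dual_expansion[of f x] dual_expansion[of g x] assms ..
qed

text \<open>Each coefficient is the 3x3 minor of the coordinates of \<open>x\<close>, \<open>y\<close>, \<open>z\<close>.\<close>

lemma bracket_expansion:
  fixes br :: "'a \<Rightarrow> 'a \<Rightarrow> 'a \<Rightarrow> 'a" and f :: "'a dual"
  assumes br: "three_lie_algebra br"
  defines "m \<equiv> \<lambda>a b c x y z. dual_apply (dual_tensor
    (coord {e1, e2, e3, e4} a \<otimes> coord {e1, e2, e3, e4} b \<otimes> coord {e1, e2, e3, e4} c)) (wedge x y z)"
  shows "dual_apply f (br x y z) =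
      m e1 e2 e3 x y z * dual_apply f (br e1 e2 e3) + m e1 e2 e4 x y z * dual_apply f (br e1 e2 e4) +
      m e1 e3 e4 x y z * dual_apply f (br e1 e3 e4) + m e2 e3 e4 x y z * dual_apply f (br e2 e3 e4)"
proof -
  define F where "F x y z = dual_apply f (br x y z)" for x y z
  have lin: "F (x + x') y z = F x y z + F x' y z" "F (c *\<^sub>C x) y z = c * F x y z"
    "F x (y + y') z = F x y z + F x y' z" "F x (c *\<^sub>C y) z = c * F x y z"
    "F x y (z + z') = F x y z + F x y z'" "F x y (c *\<^sub>C z) = c * F x y z" for x x' y y' z z' c
    using br by (simp_all add: F_def three_lie_algebra_def trilinear_def clinear_iff dual_apply_linear)
  have skew: "F y x z = - F x y z" "F x z y = - F x y z" for x y z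
    using br unfolding F_def three_lie_algebra_def skew_symmetric3_def by (metis dual_apply_linear(3))+
  \<comment> \<open>Skew-symmetry makes each such value its own negative, hence zero over the
    complex numbers.\<close>
  have diag: "F x x z = 0" "F x z z = 0" "F x z x = 0" for x z
    using skew(1)[of x x z] skew(2)[of x z z] skew(1)[of x x z] skew(2)[of x z x] by simp_all
  \<comment> \<open>Swaps of adjacent arguments, restricted to basis vectors in the wrong order:
    rewriting sorts the arguments and terminates, whereas general skew-symmetry would loop.\<close>
  note ord =
    skew(1)[of e1 e2] skew(1)[of e1 e3] skew(1)[of e1 e4]
    skew(1)[of e2 e3] skew(1)[of e2 e4] skew(1)[of e3 e4]
    skew(2)[of _ e1 e2] skew(2)[of _ e1 e3] skew(2)[of _ e1 e4] skew(2)[of _ e2 e3]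
    skew(2)[of _ e2 e4] skew(2)[of _ e3 e4]
  have "F x y z = F (co e1 x *\<^sub>C e1 + co e2 x *\<^sub>C e2 + co e3 x *\<^sub>C e3 + co e4 x *\<^sub>C e4)
     (co e1 y *\<^sub>C e1 + co e2 y *\<^sub>C e2 + co e3 y *\<^sub>C e3 + co e4 y *\<^sub>C e4)
     (co e1 z *\<^sub>C e1 + co e2 z *\<^sub>C e2 + co e3 z *\<^sub>C e3 + co e4 z *\<^sub>C e4)"
    by (simp only: expansion[symmetric])
  also have "\<dots> = m e1 e2 e3 x y z * F e1 e2 e3 + m e1 e2 e4 x y z * F e1 e2 e4 +
      m e1 e3 e4 x y z * F e1 e3 e4 + m e2 e3 e4 x y z * F e2 e3 e4"
    unfolding lin ord diag by (simp add: m_def dual_tensor_wedge algebra_simps)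
  finally show ?thesis by (simp only: F_def)
qed


section \<open>Reduction to scalar identities for the dual bracket\<close>

text \<open>An \<open>ad\<close> acting on one tensor leg moves to the matching argument of
  \<open>D\<close> as \<open>dual_map\<close>, and the identity legs leave their functionals
  unchanged. Testing against all \<open>f\<close>, \<open>g\<close>, \<open>h\<close> therefore
  removes tensors from the two compatibility conditions.\<close>

lemma double_constructionI:
  fixes br :: "'a \<Rightarrow> 'a \<Rightarrow> 'a \<Rightarrow> 'a" and \<Delta> :: "'a \<Rightarrow> 'a tensor3"
  defines "D \<equiv> \<lambda>f g h. cobracket_dual \<Delta> (f \<otimes> g \<otimes> h)"
  assumes br: "three_lie_algebra br" and \<Delta>: "clinear \<Delta>"
    and skew: "skew_symmetric3 D"
    and fundamental: "\<And>f1 f2 f3 f4 f5. D f1 f2 (D f3 f4 f5) =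
      D (D f1 f2 f3) f4 f5 + D f3 (D f1 f2 f4) f5 + D f3 f4 (D f1 f2 f5)"
    and cyclic: "\<And>f g h x y z. dual_apply (D f g h) (br x y z) =
      dual_apply (D f g (dual_map (br y z) h)) x + dual_apply (D f g (dual_map (br z x) h)) y +
      dual_apply (D f g (dual_map (br x y) h)) z"
    and derivation: "\<And>f g h x y z. dual_apply (D f g h) (br x y z) =
      dual_apply (D f g (dual_map (br y z) h)) x + dual_apply (D f (dual_map (br y z) g) h) x +
      dual_apply (D (dual_map (br y z) f) g h) x"
  shows "double_construction_3_lie_bialgebra br \<Delta>"
proof -
  note lin = clinear_bracket[OF br]
  have lin_id: "clinear (id :: 'a \<Rightarrow> 'a)" by (simp add: clinear_iff)
  have [simp]: "dual_map id f = f" for f :: "'a dual"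
    by (rule dual_eqI) (simp add: dual_apply_dual_map[OF lin_id])
  have D: "dual_apply (D f g h) x = dual_apply (dual_tensor (f \<otimes> g \<otimes> h)) (\<Delta> x)" for f g h x
    by (simp add: D_def cobracket_dual_apply[OF \<Delta>])
  note tmap = dual_tensor_tensor_map[OF lin_id lin_id lin] dual_tensor_tensor_map[OF lin_id lin lin_id]
    dual_tensor_tensor_map[OF lin lin_id lin_id]
  have "three_lie_algebra D"
    unfolding three_lie_algebra_def
    using trilinear_cobracket_dual[OF \<Delta>] skew fundamental unfolding D_def by blast
  moreover have "\<Delta> (br x y z) = tensor_map id id (br y z) (\<Delta> x) + tensor_map id id (br z x) (\<Delta> y) +
      tensor_map id id (br x y) (\<Delta> z)" for x y z
    by (rule tensor3_eqI[OF indep spanning])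
      (use cyclic[of _ _ _ x y z] in \<open>simp_all add: D dual_apply_linear tmap\<close>)
  moreover have "\<Delta> (br x y z) = tensor_map id id (br y z) (\<Delta> x) + tensor_map id (br y z) id (\<Delta> x) +
      tensor_map (br y z) id id (\<Delta> x)" for x y z
    by (rule tensor3_eqI[OF indep spanning])
      (use derivation[of _ _ _ x y z] in \<open>simp_all add: D dual_apply_linear tmap\<close>)
  ultimately show ?thesis
    using br \<Delta> unfolding double_construction_3_lie_bialgebra_def D_def by blast
qed

section \<open>The four families of brackets and cobrackets\<close>

text \<open>In the last two steps below, the arguments of the dual bracket are expanded in the basis before
  \<open>cobracket_dual\<close> is evaluated, because \<open>\<Delta>\<close> is only known on basis vectors.\<close>

lemma double_construction_four_dim_derived:
  assumes br: "three_lie_algebra br" and \<Delta>: "clinear \<Delta>"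
    and br_e: "br e1 e2 e3 = e4" "br e1 e2 e4 = e3" "br e1 e3 e4 = e2" "br e2 e3 e4 = e1"
    and \<Delta>_e: "\<Delta> e1 = k *\<^sub>C wedge e2 e3 e4"
      "\<Delta> e2 = k *\<^sub>C wedge e1 e3 e4"
      "\<Delta> e3 = k *\<^sub>C wedge e1 e2 e4"
      "\<Delta> e4 = k *\<^sub>C wedge e1 e2 e3"
  shows "double_construction_3_lie_bialgebra br \<Delta>"
proof (rule double_constructionI[OF br \<Delta>])
  let ?D = "\<lambda>f g h. cobracket_dual \<Delta> (f \<otimes> g \<otimes> h)"
  note eval = cobracket_dual_apply[OF \<Delta>] \<Delta>_e dual_apply_linear dual_tensor_wedge plus_dual.rep_eq
  note eval_br = bracket_expansion[OF br] dual_apply_dual_map_bracket[OF br] br_e co_basis eval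
  show "skew_symmetric3 ?D"
    unfolding skew_symmetric3_def
    by (intro conjI allI; rule dual_basis_eqI; simp only: eval uminus_dual.rep_eq; algebra)
  \<comment> \<open>On the coordinate functionals, \<open>?D\<close> has the structure constants of
    \<open>br\<close> multiplied by \<open>k\<close>. At a basis vector the inner brackets again
    occur only through their values at basis vectors, so \<open>eval\<close> suffices.\<close>
  show "?D f1 f2 (?D f3 f4 f5) = ?D (?D f1 f2 f3) f4 f5 + ?D f3 (?D f1 f2 f4) f5 + ?D f3 f4 (?D f1 f2 f5)"
    for f1 f2 f3 f4 f5
    by (rule dual_basis_eqI; simp only: eval; algebra)
  show "dual_apply (?D f g h) (br x y z) = dual_apply (?D f g (dual_map (br y z) h)) x +
      dual_apply (?D f g (dual_map (br z x) h)) y + dual_apply (?D f g (dual_map (br x y) h)) z"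
    for f g h x y z
    by (simp only: dual_expansion[of "cobracket_dual \<Delta> _" x] dual_expansion[of "cobracket_dual \<Delta> _" y]
      dual_expansion[of "cobracket_dual \<Delta> _" z], simp only: eval_br, algebra)
  show "dual_apply (?D f g h) (br x y z) = dual_apply (?D f g (dual_map (br y z) h)) x +
      dual_apply (?D f (dual_map (br y z) g) h) x + dual_apply (?D (dual_map (br y z) f) g h) x"
    for f g h x y z
    by (simp only: dual_expansion[of "cobracket_dual \<Delta> _" x], simp only: eval_br, algebra)
qed

text \<open>Fixing the coordinate functional of \<open>e1\<close> in the dual bracket leaves a skew
  bracket on the other three. The repeated \<open>k1\<close>, \<open>k2\<close>, \<open>k3\<close>
  make its 3x3 structure matrix symmetric, which yields the Jacobi identity; they also cancel in
  pairs in the cyclic condition at \<open>e2\<close>, \<open>e3\<close>, \<open>e4\<close>. In the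
  derivation condition every \<open>ad\<close> has values in the line of \<open>e1\<close>, a factor
  of every wedge, so all terms vanish.\<close>

lemma double_construction_one_dim_derived:
  assumes br: "three_lie_algebra br" and \<Delta>: "clinear \<Delta>"
    and br_e: "br e1 e2 e3 = 0" "br e1 e2 e4 = 0" "br e1 e3 e4 = 0" "br e2 e3 e4 = e1"
    and \<Delta>_e: "\<Delta> e1 = 0"
      "\<Delta> e2 = k1 *\<^sub>C wedge e1 e2 e3 + k2 *\<^sub>C wedge e1 e2 e4 + c1 *\<^sub>C wedge e1 e3 e4"
      "\<Delta> e3 = k3 *\<^sub>C wedge e1 e2 e3 - k2 *\<^sub>C wedge e1 e3 e4 + c2 *\<^sub>C wedge e1 e2 e4"
      "\<Delta> e4 = - (k3 *\<^sub>C wedge e1 e2 e4) + k1 *\<^sub>C wedge e1 e3 e4 + c3 *\<^sub>C wedge e1 e2 e3"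
  shows "double_construction_3_lie_bialgebra br \<Delta>"
proof (rule double_constructionI[OF br \<Delta>])
  let ?D = "\<lambda>f g h. cobracket_dual \<Delta> (f \<otimes> g \<otimes> h)"
  note eval = cobracket_dual_apply[OF \<Delta>] \<Delta>_e dual_apply_linear dual_tensor_wedge plus_dual.rep_eq
  note eval_br = bracket_expansion[OF br] dual_apply_dual_map_bracket[OF br] br_e co_basis eval
  show "skew_symmetric3 ?D"
    unfolding skew_symmetric3_def
    by (intro conjI allI; rule dual_basis_eqI; simp only: eval uminus_dual.rep_eq; algebra)
  show "?D f1 f2 (?D f3 f4 f5) = ?D (?D f1 f2 f3) f4 f5 + ?D f3 (?D f1 f2 f4) f5 + ?D f3 f4 (?D f1 f2 f5)"
    for f1 f2 f3 f4 f5
    by (rule dual_basis_eqI; simp only: eval; algebra)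
  show "dual_apply (?D f g h) (br x y z) = dual_apply (?D f g (dual_map (br y z) h)) x +
      dual_apply (?D f g (dual_map (br z x) h)) y + dual_apply (?D f g (dual_map (br x y) h)) z"
    for f g h x y z
    by (simp only: dual_expansion[of "cobracket_dual \<Delta> _" x] dual_expansion[of "cobracket_dual \<Delta> _" y]
      dual_expansion[of "cobracket_dual \<Delta> _" z], simp only: eval_br, algebra)
  show "dual_apply (?D f g h) (br x y z) = dual_apply (?D f g (dual_map (br y z) h)) x +
      dual_apply (?D f (dual_map (br y z) g) h) x + dual_apply (?D (dual_map (br y z) f) g h) x"
    for f g h x y z
    by (simp only: dual_expansion[of "cobracket_dual \<Delta> _" x], simp only: eval_br, algebra)
qed

text \<open>\<Delta> vanishes on the derived algebra, spanned by \<open>e1\<close> and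
  \<open>e2\<close>. The opposite coefficients of \<open>k\<close> cancel in the cyclic condition at
  \<open>e1\<close>, \<open>e3\<close>, \<open>e4\<close> and at \<open>e2\<close>,
  \<open>e3\<close>, \<open>e4\<close>.\<close>

lemma double_construction_two_dim_derived:
  assumes br: "three_lie_algebra br" and \<Delta>: "clinear \<Delta>"
    and br_e: "br e1 e2 e3 = 0" "br e1 e2 e4 = 0" "br e1 e3 e4 = e2" "br e2 e3 e4 = e1"
    and \<Delta>_e: "\<Delta> e1 = 0"
      "\<Delta> e2 = 0"
      "\<Delta> e3 = k *\<^sub>C wedge e1 e2 e3 + c1 *\<^sub>C wedge e1 e2 e4"
      "\<Delta> e4 = - (k *\<^sub>C wedge e1 e2 e4) + c2 *\<^sub>C wedge e1 e2 e3"
  shows "double_construction_3_lie_bialgebra br \<Delta>"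
proof (rule double_constructionI[OF br \<Delta>])
  let ?D = "\<lambda>f g h. cobracket_dual \<Delta> (f \<otimes> g \<otimes> h)"
  note eval = cobracket_dual_apply[OF \<Delta>] \<Delta>_e dual_apply_linear dual_tensor_wedge plus_dual.rep_eq
  note eval_br = bracket_expansion[OF br] dual_apply_dual_map_bracket[OF br] br_e co_basis eval
  show "skew_symmetric3 ?D"
    unfolding skew_symmetric3_def
    by (intro conjI allI; rule dual_basis_eqI; simp only: eval uminus_dual.rep_eq; algebra)
  show "?D f1 f2 (?D f3 f4 f5) = ?D (?D f1 f2 f3) f4 f5 + ?D f3 (?D f1 f2 f4) f5 + ?D f3 f4 (?D f1 f2 f5)"
    for f1 f2 f3 f4 f5
    by (rule dual_basis_eqI; simp only: eval; algebra)
  show "dual_apply (?D f g h) (br x y z) = dual_apply (?D f g (dual_map (br y z) h)) x +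
      dual_apply (?D f g (dual_map (br z x) h)) y + dual_apply (?D f g (dual_map (br x y) h)) z"
    for f g h x y z
    by (simp only: dual_expansion[of "cobracket_dual \<Delta> _" x] dual_expansion[of "cobracket_dual \<Delta> _" y]
      dual_expansion[of "cobracket_dual \<Delta> _" z], simp only: eval_br, algebra)
  show "dual_apply (?D f g h) (br x y z) = dual_apply (?D f g (dual_map (br y z) h)) x +
      dual_apply (?D f (dual_map (br y z) g) h) x + dual_apply (?D (dual_map (br y z) f) g h) x"
    for f g h x y z
    by (simp only: dual_expansion[of "cobracket_dual \<Delta> _" x], simp only: eval_br, algebra)
qed

text \<open>Dual brackets are multiples of the coordinate functional of \<open>e4\<close>, which the
  dual bracket annihilates, so iterated ones vanish. \<Delta> vanishes on the span of
  \<open>e1\<close>, \<open>e2\<close>, \<open>e3\<close>; each \<open>ad\<close> acts on that span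
  with trace zero and so kills \<open>wedge e1 e2 e3\<close>, while \<open>br e1 e2 e3 = 0\<close>
  settles the cyclic condition.\<close>

lemma double_construction_three_dim_derived:
  assumes br: "three_lie_algebra br" and \<Delta>: "clinear \<Delta>"
    and br_e: "br e1 e2 e3 = 0" "br e1 e2 e4 = e3" "br e1 e3 e4 = e2" "br e2 e3 e4 = e1"
    and \<Delta>_e: "\<Delta> e1 = 0"
      "\<Delta> e2 = 0"
      "\<Delta> e3 = 0"
      "\<Delta> e4 = c *\<^sub>C wedge e1 e2 e3"
  shows "double_construction_3_lie_bialgebra br \<Delta>"
proof (rule double_constructionI[OF br \<Delta>])
  let ?D = "\<lambda>f g h. cobracket_dual \<Delta> (f \<otimes> g \<otimes> h)"
  note eval = cobracket_dual_apply[OF \<Delta>] \<Delta>_e dual_apply_linear dual_tensor_wedge plus_dual.rep_eq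
  note eval_br = bracket_expansion[OF br] dual_apply_dual_map_bracket[OF br] br_e co_basis eval
  show "skew_symmetric3 ?D"
    unfolding skew_symmetric3_def
    by (intro conjI allI; rule dual_basis_eqI; simp only: eval uminus_dual.rep_eq; algebra)
  show "?D f1 f2 (?D f3 f4 f5) = ?D (?D f1 f2 f3) f4 f5 + ?D f3 (?D f1 f2 f4) f5 + ?D f3 f4 (?D f1 f2 f5)"
    for f1 f2 f3 f4 f5
    by (rule dual_basis_eqI; simp only: eval; algebra)
  show "dual_apply (?D f g h) (br x y z) = dual_apply (?D f g (dual_map (br y z) h)) x +
      dual_apply (?D f g (dual_map (br z x) h)) y + dual_apply (?D f g (dual_map (br x y) h)) z"
    for f g h x y z
    by (simp only: dual_expansion[of "cobracket_dual \<Delta> _" x] dual_expansion[of "cobracket_dual \<Delta> _" y]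
      dual_expansion[of "cobracket_dual \<Delta> _" z], simp only: eval_br, algebra)
  show "dual_apply (?D f g h) (br x y z) = dual_apply (?D f g (dual_map (br y z) h)) x +
      dual_apply (?D f (dual_map (br y z) g) h) x + dual_apply (?D (dual_map (br y z) f) g h) x"
    for f g h x y z
    by (simp only: dual_expansion[of "cobracket_dual \<Delta> _" x], simp only: eval_br, algebra)
qed

end

theorem theorem4p8:
  fixes br :: "'a::complex_vector \<Rightarrow> 'a \<Rightarrow> 'a \<Rightarrow> 'a"
    and \<Delta> :: "'a \<Rightarrow> 'a tensor3"
    and e1 e2 e3 e4 :: 'a
    and k k1 k2 k3 c c1 c2 c3 :: complex
  assumes "three_lie_algebra br"
    and "distinct [e1, e2, e3, e4]"
    and "cvector.independent {e1, e2, e3, e4}"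
    and "cvector.span {e1, e2, e3, e4} = UNIV"
    and "clinear \<Delta>"
  shows
    "(br e1 e2 e3 = e4 \<and> br e1 e2 e4 = e3 \<and> br e1 e3 e4 = e2 \<and> br e2 e3 e4 = e1 \<and>
      \<Delta> e1 = k *\<^sub>C wedge e2 e3 e4 \<and>
      \<Delta> e2 = k *\<^sub>C wedge e1 e3 e4 \<and>
      \<Delta> e3 = k *\<^sub>C wedge e1 e2 e4 \<and>
      \<Delta> e4 = k *\<^sub>C wedge e1 e2 e3
        \<longrightarrow> double_construction_3_lie_bialgebra br \<Delta>) \<and>
     (br e1 e2 e3 = 0 \<and> br e1 e2 e4 = 0 \<and> br e1 e3 e4 = 0 \<and> br e2 e3 e4 = e1 \<and>
      \<Delta> e1 = 0 \<and>
      \<Delta> e2 = k1 *\<^sub>C wedge e1 e2 e3 + k2 *\<^sub>C wedge e1 e2 e4 + c1 *\<^sub>C wedge e1 e3 e4 \<and>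
      \<Delta> e3 = k3 *\<^sub>C wedge e1 e2 e3 - k2 *\<^sub>C wedge e1 e3 e4 + c2 *\<^sub>C wedge e1 e2 e4 \<and>
      \<Delta> e4 = - (k3 *\<^sub>C wedge e1 e2 e4) + k1 *\<^sub>C wedge e1 e3 e4 + c3 *\<^sub>C wedge e1 e2 e3
        \<longrightarrow> double_construction_3_lie_bialgebra br \<Delta>) \<and>
     (br e1 e2 e3 = 0 \<and> br e1 e2 e4 = 0 \<and> br e1 e3 e4 = e2 \<and> br e2 e3 e4 = e1 \<and>
      \<Delta> e1 = 0 \<and>
      \<Delta> e2 = 0 \<and>
      \<Delta> e3 = k *\<^sub>C wedge e1 e2 e3 + c1 *\<^sub>C wedge e1 e2 e4 \<and>
      \<Delta> e4 = - (k *\<^sub>C wedge e1 e2 e4) + c2 *\<^sub>C wedge e1 e2 e3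
        \<longrightarrow> double_construction_3_lie_bialgebra br \<Delta>) \<and>
     (br e1 e2 e3 = 0 \<and> br e1 e2 e4 = e3 \<and> br e1 e3 e4 = e2 \<and> br e2 e3 e4 = e1 \<and>
      \<Delta> e1 = 0 \<and>
      \<Delta> e2 = 0 \<and>
      \<Delta> e3 = 0 \<and>
      \<Delta> e4 = c *\<^sub>C wedge e1 e2 e3
        \<longrightarrow> double_construction_3_lie_bialgebra br \<Delta>)"
proof -
  interpret basis4 e1 e2 e3 e4
    using assms(2-4) by unfold_locales
  show ?thesis
    using double_construction_four_dim_derived[OF assms(1,5)]
      double_construction_one_dim_derived[OF assms(1,5)]
      double_construction_two_dim_derived[OF assms(1,5)]
      double_construction_three_dim_derived[OF assms(1,5)]
    by (intro conjI impI; elim conjE) blast+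
qed

end
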